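(* Let $\eta\in(0,\infty)$, and let $S$ be an unbounded characteristic subset of $[0,\infty)$. Let $X$ be an ultranormal $\sigma$-compact locally compact Hausdorff space, and let $A$ be a non-empty non-compact closed subset of $X$. If $d\in\mathrm{UMet}(A;S)$ is proper, then there exists a proper metric $D\in\mathrm{UMet}(X;S)$ such that $D|_{A^{2}}=d$ and $A$ is $\eta$-dense in $(X,D)$.
   Context: A metric $d$ on a set $X$ is an ultrametric if $d(x,y)\le \max\{d(x,z),d(z,y)\}$ for all $x,y,z\in X$. For a topological space $X$ and $S\subset[0,\infty)$ with $0\in S$, $\mathrm{UMet}(X;S)$ denotes the set of all ultrametrics on $X$ that take values in $S$ and generate the given topology of $X$. A subset $A$ of $X$ carries the subspace topology. A subset $S$ of $[0,\infty)$ is characteristic if $0\in S$ and for every $r\in(0,\infty)$ there exists $s\in S\setminus\{0\}$ with $s\le r$. A topological space $X$ is ultranormal if for every pair $A,B$ of disjoint closed subsets of $X$ there is a clopen set $V$ with $A\subset V$ and $V\cap B=\emptyset$. A metric is proper if all bounded closed subsets are compact. For a metric space $(Z,h)$ and $\eta\in(0,\infty)$, a subset $E$ of $Z$ is $\eta$-dense in $(Z,h)$ if for every $x\in Z$ there exists $y\in E$ with $h(x,y)\le\eta$. A space is $\sigma$-compact if it is a countable union of compact subspaces, and locally compact if every point has a compact neighborhood.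
   Formalization: The space X is additionally assumed to be metrizable; without this the claim is false, e.g. for X the disjoint union of the discrete natural numbers (as A) and an uncountable power of {0,1}, where UMet(X;S) is empty. *)

theory Defs
  imports "HOL-Analysis.Analysis"
begin

definition ultrametric_on :: "'a set \<Rightarrow> ('a \<Rightarrow> 'a \<Rightarrow> real) \<Rightarrow> bool" where
  "ultrametric_on M d \<longleftrightarrow>
     Metric_space M d \<and>
     (\<forall>x\<in>M. \<forall>y\<in>M. \<forall>z\<in>M. d x y \<le> max (d x z) (d z y))"

text \<open>
  As always with \<^locale>\<open>Metric_space\<close>, elements are total functions, of which only the values
  on the underlying set matter; the locale also asks for symmetry and nonnegativity off that
  set, which every metric on the set satisfies after extension by zero.
\<close>

definition UMet :: "'a topology \<Rightarrow> real set \<Rightarrow> ('a \<Rightarrow> 'a \<Rightarrow> real) set" where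
  "UMet X S =
     {d. ultrametric_on (topspace X) d \<and>
         (\<forall>x\<in>topspace X. \<forall>y\<in>topspace X. d x y \<in> S) \<and>
         Metric_space.mtopology (topspace X) d = X}"

definition characteristic :: "real set \<Rightarrow> bool" where
  "characteristic S \<longleftrightarrow>
     S \<subseteq> {0..} \<and> 0 \<in> S \<and> (\<forall>r>0. \<exists>s\<in>S - {0}. s \<le> r)"

definition ultranormal_space :: "'a topology \<Rightarrow> bool" where
  "ultranormal_space X \<longleftrightarrow>
     (\<forall>A B. closedin X A \<and> closedin X B \<and> A \<inter> B = {} \<longrightarrow>
        (\<exists>V. openin X V \<and> closedin X V \<and> A \<subseteq> V \<and> V \<inter> B = {}))"

definition sigma_compact_space :: "'a topology \<Rightarrow> bool" where
  "sigma_compact_space X \<longleftrightarrow>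
     (\<exists>\<K>. countable \<K> \<and> (\<forall>K\<in>\<K>. compactin X K) \<and> \<Union>\<K> = topspace X)"

definition proper_metric_on :: "'a set \<Rightarrow> ('a \<Rightarrow> 'a \<Rightarrow> real) \<Rightarrow> bool" where
  "proper_metric_on M d \<longleftrightarrow>
     Metric_space M d \<and>
     (\<forall>C. Metric_space.mbounded M d C \<and> closedin (Metric_space.mtopology M d) C \<longrightarrow>
        compactin (Metric_space.mtopology M d) C)"

definition eta_dense :: "real \<Rightarrow> 'a set \<Rightarrow> ('a \<Rightarrow> 'a \<Rightarrow> real) \<Rightarrow> 'a set \<Rightarrow> bool" where
  "eta_dense \<eta> Z h E \<longleftrightarrow> E \<subseteq> Z \<and> (\<forall>x\<in>Z. \<exists>y\<in>E. h x y \<le> \<eta>)"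

end

theory Submission
  imports Defs
begin

text \<open>
  Partition \<open>X\<close> into countably many compact open pieces, numbered by \<open>k\<close>, and choose a
  sequence of labels \<open>C 0 = k, C 1, \<dots>\<close> whose cylinders form a neighbourhood basis of clopen sets.
  A point \<open>x \<notin> A\<close> is retracted to a point of \<open>A\<close> in the smallest cylinder around \<open>x\<close> that meets
  \<open>A\<close>; a piece disjoint from \<open>A\<close> is instead sent to a single point of \<open>A\<close> lying in a later piece,
  which is possible because \<open>A\<close> is not compact. The resulting continuous retraction \<open>r\<close> never
  decreases \<open>k\<close>, so preimages of compact sets are compact. Then
  \<open>D x y = max (d (r x) (r y)) (e x y)\<close> works, where \<open>e \<le> \<eta>\<close> is an \<open>S\<close>-valued continuous
  pseudo-ultrametric that vanishes on \<open>A \<times> A\<close> and separates each point outside \<open>A\<close> from all others.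
\<close>

section \<open>Clopen covers, compact open pieces and a countable clopen base\<close>

text \<open>Ultranormality separates the closed point from the complement of
  \<open>U \<inter> W\<close>, where the open set \<open>W\<close> lies in a compact set; the clopen
  separator is then closed in a compact set.\<close>

lemma ultranormal_compact_clopen_neighbourhood:
  assumes "ultranormal_space X" "locally_compact_space X" "Hausdorff_space X"
    and U: "openin X U" "x \<in> U"
  obtains V where "openin X V" "closedin X V" "compactin X V" "x \<in> V" "V \<subseteq> U"
proof -
  have x: "x \<in> topspace X"
    using U openin_subset by blast
  obtain W K where WK: "openin X W" "compactin X K" "x \<in> W" "W \<subseteq> K"
    using assms x unfolding locally_compact_space_def by blast
  have "closedin X {x}"
    using assms x by (simp add: Hausdorff_imp_t1_space closedin_t1_singleton)
  moreover have "closedin X (topspace X - U \<inter> W)"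
    using U WK by blast
  moreover have "{x} \<inter> (topspace X - U \<inter> W) = {}"
    using U WK by blast
  ultimately obtain V where V: "openin X V" "closedin X V" "{x} \<subseteq> V" "V \<inter> (topspace X - U \<inter> W) = {}"
    using assms(1) unfolding ultranormal_space_def by metis
  have "V \<subseteq> U \<inter> W"
    using V openin_subset by blast
  with V WK that show thesis
    by (metis closed_compactin insert_subset le_inf_iff order_trans)
qed

lemma sigma_compact_imp_Lindelof_space:
  assumes "sigma_compact_space X"
  shows "Lindelof_space X"
proof -
  obtain \<K> where \<K>: "countable \<K>" "\<And>K. K \<in> \<K> \<Longrightarrow> compactin X K" "\<Union>\<K> = topspace X"
    using assms unfolding sigma_compact_space_def by auto
  have "Lindelof_space (subtopology X K)" if "K \<in> \<K>" for K
    using \<K>(2)[OF that] by (simp add: compact_imp_Lindelof_space compact_space_subtopology)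
  then have "Lindelof_space (subtopology X (\<Union>\<K>))"
    using \<K> by (intro Lindelof_space_Union) auto
  then show ?thesis
    by (simp add: \<K>(3))
qed

lemma Lindelof_sequential_subcover:
  assumes "Lindelof_space X"
    and "\<And>x. x \<in> topspace X \<Longrightarrow> \<exists>U. openin X U \<and> x \<in> U \<and> P U"
    and "P {}"
  obtains W :: "nat \<Rightarrow> 'a set"
  where "\<And>n. openin X (W n)" "\<And>n. P (W n)" "(\<Union>n. W n) = topspace X"
proof -
  let ?\<U> = "{U. openin X U \<and> P U}"
  have "\<Union>?\<U> = topspace X"
    using assms(2) openin_subset by fastforce
  then obtain \<V> where \<V>: "countable \<V>" "\<V> \<subseteq> ?\<U>" "\<Union>\<V> = topspace X"
    using Lindelof_spaceD[OF assms(1), of ?\<U>] by auto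
  \<comment> \<open>The subcover may be empty; adding \<open>{}\<close>, which satisfies
    \<open>P\<close> by hypothesis, makes enumeration by all naturals possible.\<close>
  have ran: "range (from_nat_into (insert {} \<V>)) = insert {} \<V>"
    using \<V>(1) by (intro range_from_nat_into) auto
  show thesis
  proof
    fix n
    have "from_nat_into (insert {} \<V>) n \<in> insert {} \<V>"
      using ran by blast
    then show "openin X (from_nat_into (insert {} \<V>) n)" "P (from_nat_into (insert {} \<V>) n)"
      using \<V>(2) assms(3) by auto
  next
    show "(\<Union>n. from_nat_into (insert {} \<V>) n) = topspace X"
      using ran \<V>(3) by simp
  qed
qed

text \<open>Number each point by the first member of a countable cover by compact clopen sets that
  contains it. A fibre is an open set minus finitely many closed ones, and a sublevel set is a
  finite union of compact sets.\<close>

lemma compact_open_partition: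
  assumes X: "ultranormal_space X" "locally_compact_space X" "Hausdorff_space X"
      "sigma_compact_space X"
  obtains k :: "'a \<Rightarrow> nat"
  where "\<And>n. openin X {x \<in> topspace X. k x = n}"
    and "\<And>n. compactin X {x \<in> topspace X. k x \<le> n}"
proof -
  have "\<exists>U. openin X U \<and> x \<in> U \<and> closedin X U \<and> compactin X U" if "x \<in> topspace X" for x
    using ultranormal_compact_clopen_neighbourhood[OF X(1-3) openin_topspace that] by metis
  then obtain W :: "nat \<Rightarrow> 'a set" where W: "\<And>n. openin X (W n)"
      "\<And>n. closedin X (W n) \<and> compactin X (W n)" "(\<Union>n. W n) = topspace X"
    by (rule Lindelof_sequential_subcover[OF sigma_compact_imp_Lindelof_space[OF X(4)],
          where P = "\<lambda>U. closedin X U \<and> compactin X U"]) auto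
  define k where "k x = (LEAST n. x \<in> W n)" for x
  have kW: "x \<in> W (k x)" if "x \<in> topspace X" for x
    unfolding k_def using that W(3) by (metis LeastI UN_E)
  have kle: "k x \<le> n" if "x \<in> W n" for x n
    unfolding k_def using that by (rule Least_le)
  have sub: "W n \<subseteq> topspace X" for n
    using W(3) by blast
  show thesis
  proof
    fix n
    have "{x \<in> topspace X. k x = n} = W n - (\<Union>i<n. W i)"
    proof (intro set_eqI iffI)
      fix x assume x: "x \<in> {x \<in> topspace X. k x = n}"
      then show "x \<in> W n - (\<Union>i<n. W i)"
        using kW kle by fastforce
    next
      fix x assume x: "x \<in> W n - (\<Union>i<n. W i)"
      then have "x \<in> topspace X" using sub by blast
      moreover from this x have "\<not> k x < n" using kW by blast
      ultimately show "x \<in> {x \<in> topspace X. k x = n}"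
        using x kle by (simp add: order_antisym)
    qed
    moreover have "closedin X (\<Union>i<n. W i)"
      using W by (intro closedin_Union) auto
    ultimately show "openin X {x \<in> topspace X. k x = n}"
      using W(1) by (simp add: openin_diff)
  next
    fix n
    have "{x \<in> topspace X. k x \<le> n} = (\<Union>i\<le>n. W i)"
    proof (intro set_eqI iffI)
      fix x assume "x \<in> (\<Union>i\<le>n. W i)"
      then obtain i where "i \<le> n" "x \<in> W i" by blast
      then show "x \<in> {x \<in> topspace X. k x \<le> n}"
        using kle[of x i] sub[of i] by auto
    qed (use kW in auto)
    moreover have "compactin X (\<Union>i\<le>n. W i)"
      using W by (intro compactin_Union) auto
    ultimately show "compactin X {x \<in> topspace X. k x \<le> n}"
      by simp
  qed
qed

text \<open>For every \<open>n\<close>, countably many clopen sets of size about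
  \<open>1 / Suc n\<close> cover the space; the covers for all \<open>n\<close> together form a
  base.\<close>

lemma countable_clopen_base:
  assumes X: "ultranormal_space X" "locally_compact_space X" "Hausdorff_space X"
      "sigma_compact_space X" "metrizable_space X"
  obtains V :: "nat \<Rightarrow> 'a set"
  where "\<And>n. openin X (V n)" "\<And>n. closedin X (V n)"
    and "\<And>U x. openin X U \<Longrightarrow> x \<in> U \<Longrightarrow> \<exists>n. x \<in> V n \<and> V n \<subseteq> U"
proof -
  obtain M m where "Metric_space M m" and Xm: "X = Metric_space.mtopology M m"
    using X(5) unfolding metrizable_space_def by blast
  then interpret Metric_space M m by simp
  \<comment> \<open>The centre of the ball is left free so that \<open>P\<close> does not depend on
    the covered point and holds for \<open>{}\<close>. The price is a detour through the centre,
    hence the bound \<open>\<epsilon> / 2\<close> below.\<close>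
  define P where "P n U \<longleftrightarrow> closedin X U \<and> (\<exists>x. U \<subseteq> mball x (inverse (Suc n)))" for n U
  have "\<exists>W::nat \<Rightarrow> 'a set. (\<forall>i. openin X (W i)) \<and> (\<forall>i. P n (W i)) \<and> (\<Union>i. W i) = topspace X" for n
  proof -
    have "\<exists>U. openin X U \<and> x \<in> U \<and> P n U" if x: "x \<in> topspace X" for x
    proof -
      have "openin X (mball x (inverse (Suc n)))" "x \<in> mball x (inverse (Suc n))"
        using x by (auto simp: Xm)
      from ultranormal_compact_clopen_neighbourhood[OF X(1-3) this] show ?thesis
        unfolding P_def by metis
    qed
    moreover have "P n {}"
      unfolding P_def by simp
    ultimately show ?thesis
      by (metis Lindelof_sequential_subcover[OF sigma_compact_imp_Lindelof_space[OF X(4)]])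
  qed
  then obtain W :: "nat \<Rightarrow> nat \<Rightarrow> 'a set" where
    W: "\<And>n i. openin X (W n i)" "\<And>n i. P n (W n i)" "\<And>n. (\<Union>i. W n i) = topspace X"
    by metis
  define V where "V j = (case prod_decode j of (n, i) \<Rightarrow> W n i)" for j
  show thesis
  proof
    show "openin X (V j)" "closedin X (V j)" for j
      using W P_def by (auto simp: V_def split: prod.split)
    fix U x assume U: "openin X U" "x \<in> U"
    then obtain \<epsilon> where \<epsilon>: "\<epsilon> > 0" "mball x \<epsilon> \<subseteq> U"
      using Xm openin_mtopology by metis
    obtain n where n: "inverse (Suc n) < \<epsilon> / 2"
      using reals_Archimedean[of "\<epsilon> / 2"] \<epsilon>(1) by auto
    have "x \<in> topspace X"
      using U openin_subset by blast
    then obtain i where i: "x \<in> W n i"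
      using W(3) by blast
    obtain c where c: "W n i \<subseteq> mball c (inverse (Suc n))"
      using W(2) P_def by meson
    have "W n i \<subseteq> mball x \<epsilon>"
    proof
      fix y assume "y \<in> W n i"
      with i c have "m c x < inverse (Suc n)" "m c y < inverse (Suc n)"
        and M: "c \<in> M" "x \<in> M" "y \<in> M" by auto
      then have "m x y < \<epsilon>"
        using triangle[of x c y] commute[of x c] n by linarith
      then show "y \<in> mball x \<epsilon>"
        using M by simp
    qed
    then have "x \<in> V (prod_encode (n, i)) \<and> V (prod_encode (n, i)) \<subseteq> U"
      using i \<epsilon> by (auto simp: V_def)
    then show "\<exists>n. x \<in> V n \<and> V n \<subseteq> U" ..
  qed
qed

section \<open>Cylinders of label sequences and the retraction onto \<open>A\<close>\<close>

text \<open>For fixed \<open>n\<close> these sets partition the space, and larger \<open>n\<close>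
  refines the partition, so they behave like balls of an ultrametric. Depth 0 is the whole
  space.\<close>

definition cylinder :: "'a topology \<Rightarrow> (nat \<Rightarrow> 'a \<Rightarrow> 'b) \<Rightarrow> nat \<Rightarrow> 'a \<Rightarrow> 'a set" where
  "cylinder X C n x = {y \<in> topspace X. \<forall>i<n. C i y = C i x}"

lemma cylinder_self: "x \<in> topspace X \<Longrightarrow> x \<in> cylinder X C n x"
  by (simp add: cylinder_def)

lemma cylinder_antimono: "m \<le> n \<Longrightarrow> cylinder X C n x \<subseteq> cylinder X C m x"
  by (auto simp: cylinder_def)

lemma cylinder_eq: "y \<in> cylinder X C n x \<Longrightarrow> m \<le> n \<Longrightarrow> cylinder X C m y = cylinder X C m x"
  by (auto simp: cylinder_def)

lemma openin_cylinder:
  assumes "\<And>i j. openin X {y \<in> topspace X. C i y = j}"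
  shows "openin X (cylinder X C n x)"
proof (induction n)
  case 0
  then show ?case by (simp add: cylinder_def)
next
  case (Suc n)
  have "cylinder X C (Suc n) x = cylinder X C n x \<inter> {y \<in> topspace X. C n y = C n x}"
    by (auto simp: cylinder_def less_Suc_eq)
  then show ?case
    using Suc assms by (simp add: openin_Int)
qed

text \<open>Off \<open>A\<close>, the value of \<open>r\<close> depends only on a cylinder missing
  \<open>A\<close>, so \<open>r\<close> is locally constant there. At a point of \<open>A\<close>,
  continuity holds because \<open>r\<close> does not leave the cylinders of positive depth around
  that point.\<close>

lemma cylinder_retraction:
  fixes C :: "nat \<Rightarrow> 'a \<Rightarrow> nat"
  assumes C: "\<And>i j. openin X {y \<in> topspace X. C i y = j}"
    and basis: "\<And>U x. openin X U \<Longrightarrow> x \<in> U \<Longrightarrow> \<exists>n. cylinder X C n x \<subseteq> U"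
    and A: "closedin X A" "\<And>n. \<exists>a\<in>A. n < C 0 a"
  obtains r where "continuous_map X (subtopology X A) r"
    and "\<And>x. x \<in> A \<Longrightarrow> r x = x"
    and "\<And>x. x \<in> topspace X \<Longrightarrow> C 0 x \<le> C 0 (r x)"
proof -
  have AX: "A \<subseteq> topspace X"
    using A(1) closedin_subset by blast
  obtain a where a: "\<And>n. a n \<in> A" "\<And>n. n < C 0 (a n)"
    using A(2) by metis
  let ?E = "cylinder X C"
  have E_open: "openin X (?E n x)" for n x
    using C by (rule openin_cylinder)
  define l where "l x = (LEAST n. ?E n x \<inter> A = {})" for x
  \<comment> \<open>For a point of the space off \<open>A\<close>, \<open>l x - 1\<close> is the
    last depth at which its cylinder meets \<open>A\<close>. If that depth is 0, the whole piece of
    \<open>x\<close> misses \<open>A\<close>, and \<open>a (C 0 x)\<close> supplies a larger first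
    label. The \<open>SOME\<close> term depends on \<open>x\<close> only through the cylinder, so
    points sharing that cylinder share the choice.\<close>
  define r where "r x = (if x \<in> A then x else if l x \<le> 1 then a (C 0 x)
      else SOME y. y \<in> ?E (l x - 1) x \<inter> A)" for x
  have l_disj: "?E (l x) x \<inter> A = {}" if x: "x \<in> topspace X - A" for x
  proof -
    obtain n where "?E n x \<subseteq> topspace X - A"
      using basis[of "topspace X - A" x] A(1) x by blast
    then have "?E n x \<inter> A = {}" by blast
    then show ?thesis
      unfolding l_def by (rule LeastI)
  qed
  have l_meet: "?E n x \<inter> A \<noteq> {}" if "n < l x" for n x
    using not_less_Least that unfolding l_def by blast
  have l_gt: "n < l x" if x: "x \<in> topspace X - A" and "?E n x \<inter> A \<noteq> {}" for n x
    using l_disj[OF x] that(2) cylinder_antimono[of "l x" n X C x] by (metis Int_mono disjoint_iff leI order_refl subset_empty)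
  have r_E: "r x \<in> ?E (l x - 1) x \<inter> A" if "x \<notin> A" "1 < l x" for x
  proof -
    have "?E (l x - 1) x \<inter> A \<noteq> {}"
      using that by (intro l_meet) simp
    then have "(SOME y. y \<in> ?E (l x - 1) x \<inter> A) \<in> ?E (l x - 1) x \<inter> A"
      using some_in_eq by blast
    then show ?thesis
      using that by (simp add: r_def)
  qed
  have rA: "r x \<in> A" for x
    using a r_E[of x] by (cases "x \<in> A"; cases "1 < l x") (auto simp: r_def)
  have r_id: "r x = x" if "x \<in> A" for x
    using that by (simp add: r_def)
  \<comment> \<open>With \<open>1 \<le> n\<close>, the inequality \<open>n < l y\<close> excludes
    the fallback value \<open>a (C 0 y)\<close>, which may lie in a different piece.\<close>
  have near: "r y \<in> ?E n x" if x: "x \<in> A" and n: "1 \<le> n" and y: "y \<in> ?E n x" for x y n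
  proof (cases "y \<in> A")
    case True
    then show ?thesis using y r_id by simp
  next
    case False
    have yX: "y \<in> topspace X - A"
      using y False by (simp add: cylinder_def)
    have "x \<in> ?E n y"
      using y x AX by (auto simp: cylinder_def)
    then have "n < l y"
      using l_gt[OF yX, of n] x by blast
    then have "r y \<in> ?E (l y - 1) y"
      using r_E[OF False] n by simp
    then have "r y \<in> ?E n y"
      using \<open>n < l y\<close> by (simp add: cylinder_def)
    then show ?thesis
      using cylinder_eq[OF y] by simp
  qed
  \<comment> \<open>All cylinders of \<open>x\<close> and \<open>y\<close> up to depth
    \<open>l x\<close> coincide, so both points have the same \<open>l\<close> and the same value is
    selected for them.\<close>
  have const: "r y = r x" if x: "x \<in> topspace X - A" and y: "y \<in> ?E (l x) x" for x y
  proof -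
    have yA: "y \<notin> A"
      using y l_disj[OF x] by blast
    have E: "?E n y = ?E n x" if "n \<le> l x" for n
      using cylinder_eq[OF y that] .
    \<comment> \<open>At depth 0 the cylinder is the whole space and meets \<open>A\<close>.
      Positivity makes membership in the cylinder of depth \<open>l x\<close> fix the label
      \<open>C 0\<close>.\<close>
    have pos: "0 < l x"
      using l_gt[OF x, of 0] a(1)[of 0] AX by (auto simp: cylinder_def)
    have "l y = l x"
      unfolding l_def[of y]
    proof (rule Least_equality)
      show "?E (l x) y \<inter> A = {}"
        using E[of "l x"] l_disj[OF x] by simp
      show "l x \<le> n" if "?E n y \<inter> A = {}" for n
        using E[of n] l_meet[of n x] that by force
    qed
    moreover have "C 0 y = C 0 x"
      using y pos by (simp add: cylinder_def)
    moreover have "?E (l x - 1) y = ?E (l x - 1) x"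
      using E by simp
    ultimately show ?thesis
      using x yA by (simp add: r_def)
  qed
  show thesis
  proof
    show "continuous_map X (subtopology X A) r"
    proof (rule continuous_map_into_subtopology)
      show "r \<in> topspace X \<rightarrow> A"
        using rA by blast
      show "continuous_map X X r"
        unfolding continuous_map
      proof (intro conjI allI impI)
        show "r ` topspace X \<subseteq> topspace X"
          using rA AX by blast
        fix U assume U: "openin X U"
        show "openin X {x \<in> topspace X. r x \<in> U}"
        proof (subst openin_subopen, intro ballI)
          fix x assume x: "x \<in> {x \<in> topspace X. r x \<in> U}"
          show "\<exists>T. openin X T \<and> x \<in> T \<and> T \<subseteq> {x \<in> topspace X. r x \<in> U}"
          proof (cases "x \<in> A")
            case True
            then obtain n where "?E n x \<subseteq> U"
              using basis[OF U] x r_id by force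
            \<comment> \<open>One extra level guarantees the positive depth that \<open>near\<close>
              requires.\<close>
            then have "?E (Suc n) x \<subseteq> U"
              using cylinder_antimono[of n "Suc n" X C x] by auto
            then have "r y \<in> U" if "y \<in> ?E (Suc n) x" for y
              using near[OF True, of "Suc n" y] that by auto
            then have "?E (Suc n) x \<subseteq> {x \<in> topspace X. r x \<in> U}"
              by (auto simp: cylinder_def)
            then show ?thesis
              using E_open x cylinder_self[of x X] by (intro exI[of _ "?E (Suc n) x"]) auto
          next
            case False
            then have "r y \<in> U" if "y \<in> ?E (l x) x" for y
              using const[of x y] that x by simp
            then have "?E (l x) x \<subseteq> {x \<in> topspace X. r x \<in> U}"
              by (auto simp: cylinder_def)
            then show ?thesis
              using E_open x cylinder_self[of x X] by (intro exI[of _ "?E (l x) x"]) auto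
          qed
        qed
      qed
    qed
    show "r x = x" if "x \<in> A" for x
      using that r_id by simp
    show "C 0 x \<le> C 0 (r x)" if "x \<in> topspace X" for x
    proof (cases "x \<in> A \<or> l x \<le> 1")
      case True
      then show ?thesis
        using a(2)[of "C 0 x"] by (auto simp: r_def)
    next
      case False
      then have "r x \<in> ?E (l x - 1) x"
        using r_E[of x] by simp
      then have "C 0 (r x) = C 0 x"
        using False by (simp add: cylinder_def)
      then show ?thesis by simp
    qed
  qed
qed

section \<open>Pseudo-ultrametrics read off from label sequences\<close>

text \<open>The usual ultrametric on sequences, weighted by \<open>s\<close> and pulled back along
  the labelling; points with identical labels get distance 0.\<close>

definition label_dist :: "(nat \<Rightarrow> real) \<Rightarrow> (nat \<Rightarrow> 'a \<Rightarrow> 'b) \<Rightarrow> 'a \<Rightarrow> 'a \<Rightarrow> real" where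
  "label_dist s C x y = (if \<forall>n. C n x = C n y then 0 else s (LEAST n. C n x \<noteq> C n y))"

lemma label_dist_commute: "label_dist s C x y = label_dist s C y x"
  unfolding label_dist_def by (simp add: eq_commute[of "C n x" "C n y" for n])

lemma label_dist_values: "label_dist s C x y \<in> insert 0 (range s)"
  by (simp add: label_dist_def)

lemma label_dist_cong: "(\<And>n. C n x = C n y) \<Longrightarrow> label_dist s C x y = 0"
  by (simp add: label_dist_def)

lemma label_dist_ge:
  assumes "decseq s" "C n x \<noteq> C n y"
  shows "s n \<le> label_dist s C x y"
proof -
  have "(LEAST n. C n x \<noteq> C n y) \<le> n"
    using assms(2) by (rule Least_le)
  then show ?thesis
    using assms(2) decseqD[OF assms(1)] by (auto simp: label_dist_def)
qed

lemma label_dist_le: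
  assumes "decseq s" "0 \<le> s n" "\<And>i. i < n \<Longrightarrow> C i x = C i y"
  shows "label_dist s C x y \<le> s n"
proof (cases "\<forall>n. C n x = C n y")
  case False
  then have "C (LEAST n. C n x \<noteq> C n y) x \<noteq> C (LEAST n. C n x \<noteq> C n y) y"
    by (metis (mono_tags, lifting) LeastI)
  then have "n \<le> (LEAST n. C n x \<noteq> C n y)"
    using assms(3) leI by blast
  then show ?thesis
    using False decseqD[OF assms(1)] by (auto simp: label_dist_def)
qed (use assms(2) in \<open>simp add: label_dist_def\<close>)

text \<open>At the first index where \<open>x\<close> and \<open>y\<close> differ, \<open>z\<close>
  must differ from one of them; since \<open>s\<close> decreases, that distance is at least the
  value of \<open>s\<close> there.\<close>

lemma label_dist_ultra:
  assumes "decseq s" "\<And>n. 0 \<le> s n"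
  shows "label_dist s C x y \<le> max (label_dist s C x z) (label_dist s C z y)"
proof (cases "\<forall>n. C n x = C n y")
  case True
  then have "label_dist s C x y = 0" by (simp add: label_dist_def)
  moreover have "0 \<le> label_dist s C x z"
    using assms(2) label_dist_values[of s C x z] by auto
  ultimately show ?thesis by linarith
next
  case False
  define m where "m = (LEAST n. C n x \<noteq> C n y)"
  have "C m x \<noteq> C m y"
    unfolding m_def using False by (metis (mono_tags, lifting) LeastI)
  then consider "C m x \<noteq> C m z" | "C m z \<noteq> C m y"
    by metis
  then have "s m \<le> max (label_dist s C x z) (label_dist s C z y)"
    using label_dist_ge[of s C m] assms(1) by cases (auto intro: max.coboundedI1 max.coboundedI2)
  moreover have "label_dist s C x y = s m"
    unfolding label_dist_def m_def using False by (rule if_not_P)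
  ultimately show ?thesis by simp
qed

lemma characteristic_null_sequence:
  assumes "characteristic S" "0 < \<eta>"
  obtains s :: "nat \<Rightarrow> real"
  where "\<And>n. s n \<in> S" "\<And>n. 0 < s n" "s 0 \<le> \<eta>" "decseq s" "s \<longlonglongrightarrow> 0"
proof -
  have ex: "\<exists>t. t \<in> S \<and> 0 < t \<and> t \<le> b" if b: "0 < b" for b
  proof -
    obtain t where "t \<in> S - {0}" "t \<le> b"
      using assms(1) b unfolding characteristic_def by meson
    moreover from this have "0 \<le> t"
      using assms(1) unfolding characteristic_def by auto
    ultimately show ?thesis by (intro exI[of _ t]) auto
  qed
  \<comment> \<open>Each term is chosen in \<open>S\<close> below both its predecessor and
    \<open>\<eta> / 2 ^ n\<close>, giving monotonicity and convergence to 0 at once.\<close>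
  have "\<exists>s. \<forall>n. (s n \<in> S \<and> 0 < s n \<and> s n \<le> \<eta> / 2 ^ n) \<and> s (Suc n) \<le> s n"
  proof (rule dependent_nat_choice)
    show "\<exists>t. t \<in> S \<and> 0 < t \<and> t \<le> \<eta> / 2 ^ 0"
      using ex[of \<eta>] assms(2) by simp
    show "\<exists>u. (u \<in> S \<and> 0 < u \<and> u \<le> \<eta> / 2 ^ Suc n) \<and> u \<le> t"
      if "t \<in> S \<and> 0 < t \<and> t \<le> \<eta> / 2 ^ n" for t n
      using ex[of "min t (\<eta> / 2 ^ Suc n)"] that assms(2) by auto
  qed
  then obtain s where s: "\<And>n. s n \<in> S" "\<And>n. 0 < s n" "\<And>n. s n \<le> \<eta> / 2 ^ n"
      "\<And>n. s (Suc n) \<le> s n"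
    by blast
  have "(\<lambda>n. \<eta> / 2 ^ n) \<longlonglongrightarrow> 0"
    by (rule LIMSEQ_divide_realpow_zero) simp
  then have "s \<longlonglongrightarrow> 0"
    by (rule tendsto_sandwich[OF _ _ tendsto_const, rotated -1])
      (use s in \<open>auto intro!: always_eventually less_imp_le\<close>)
  moreover have "s 0 \<le> \<eta>"
    using s(3)[of 0] by simp
  ultimately show thesis
    using that s decseq_SucI by blast
qed

section \<open>Recognising the topology and properness from compact balls\<close>

text \<open>
  The identity from \<open>X\<close> to the metric topology is continuous, and it is a closed map on the compact
  sets that contain the balls; hence it is a homeomorphism.
\<close>

lemma (in Metric_space) mtopology_eqI_compact_balls:
  assumes M: "topspace X = M"
    and coarser: "\<And>x \<epsilon>. x \<in> M \<Longrightarrow> 0 < \<epsilon> \<Longrightarrow> \<exists>T. openin X T \<and> x \<in> T \<and> T \<subseteq> mball x \<epsilon>"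
    and compact: "\<And>x B. x \<in> M \<Longrightarrow> \<exists>K. compactin X K \<and> mcball x B \<subseteq> K"
  shows "mtopology = X" "proper_metric_on M d"
proof -
  have open_imp: "openin X U" if U: "openin mtopology U" for U
  proof (subst openin_subopen, intro ballI)
    fix x assume x: "x \<in> U"
    then obtain \<epsilon> where "0 < \<epsilon>" "mball x \<epsilon> \<subseteq> U" "x \<in> M"
      using U openin_mtopology by blast
    then show "\<exists>T. openin X T \<and> x \<in> T \<and> T \<subseteq> U"
      using coarser by (meson order_trans)
  qed
  show eq: "mtopology = X"
  proof (rule topology_eq[THEN iffD2], intro allI iffI)
    fix U assume U: "openin X U"
    show "openin mtopology U"
    proof (subst openin_subopen, intro ballI)
      fix x assume x: "x \<in> U"
      then have xM: "x \<in> M"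
        using U openin_subset M by blast
      obtain K where K: "compactin X K" "mcball x 1 \<subseteq> K"
        using compact[OF xM] by blast
      have "compactin X (K - U)"
        using closed_compactin[OF K(1), of "K - U"] closed_Int_compactin[of X "topspace X - U" K] K(1) U
          compactin_subset_topspace[OF K(1)]
        by (metis Diff_subset Int_Diff closedin_diff closedin_topspace inf.absorb_iff2 inf.commute)
      then have "compactin mtopology (K - U)"
        by (rule compactin_contractive) (use M open_imp in auto)
      then have "closedin mtopology (K - U)"
        using Hausdorff_space_mtopology compactin_imp_closedin by blast
      then have "openin mtopology (mball x 1 - (K - U))"
        by (simp add: openin_diff)
      moreover have "x \<in> mball x 1 - (K - U)"
        using x xM by simp
      moreover have "mball x 1 - (K - U) \<subseteq> U"
        using K(2) mball_subset_mcball[of x 1] by blast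
      ultimately show "\<exists>T. openin mtopology T \<and> x \<in> T \<and> T \<subseteq> U"
        by blast
    qed
  qed (use open_imp in blast)
  show "proper_metric_on M d"
    unfolding proper_metric_on_def
  proof (intro conjI allI impI)
    show "Metric_space M d" by (rule Metric_space_axioms)
    fix F assume F: "mbounded F \<and> closedin mtopology F"
    show "compactin mtopology F"
    proof (cases "F = {}")
      case False
      obtain x B where xB: "F \<subseteq> mcball x B"
        using F mbounded_def by auto
      then have "x \<in> M"
        using False by auto
      then obtain K where "compactin X K" "mcball x B \<subseteq> K"
        using compact by blast
      then show ?thesis
        using closed_compactin[of X K F] xB F eq by auto
    qed simp
  qed
qed

section \<open>Construction of the extended metric\<close>

theorem theorem4p9:
  fixes \<eta> :: real and S :: "real set"
    and X :: "'a topology" and A :: "'a set"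
    and d :: "'a \<Rightarrow> 'a \<Rightarrow> real"
  assumes "\<eta> > 0"
    and "characteristic S" and "\<not> bounded S"
    and "metrizable_space X"
    and "ultranormal_space X" and "sigma_compact_space X"
    and "locally_compact_space X" and "Hausdorff_space X"
    and "closedin X A" and "A \<noteq> {}" and "\<not> compactin X A"
    and "d \<in> UMet (subtopology X A) S" and "proper_metric_on A d"
  shows "\<exists>D. D \<in> UMet X S \<and> proper_metric_on (topspace X) D \<and>
           (\<forall>x\<in>A. \<forall>y\<in>A. D x y = d x y) \<and>
           eta_dense \<eta> (topspace X) D A"
proof -
  define M where "M = topspace X"
  have AM: "A \<subseteq> M"
    using assms(9) closedin_subset M_def by blast
  then have top_A: "topspace X \<inter> A = A"
    by (auto simp: M_def)
  have d: "Metric_space A d" "\<And>x y z. \<lbrakk>x \<in> A; y \<in> A; z \<in> A\<rbrakk> \<Longrightarrow> d x y \<le> max (d x z) (d z y)"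
      "\<And>x y. \<lbrakk>x \<in> A; y \<in> A\<rbrakk> \<Longrightarrow> d x y \<in> S"
      and d_top: "Metric_space.mtopology A d = subtopology X A"
    using assms(12) by (simp_all add: UMet_def ultrametric_on_def top_A)
  interpret A: Metric_space A d by (fact d(1))
  have S0: "0 \<in> S"
    using assms(2) by (simp add: characteristic_def)
  obtain k :: "'a \<Rightarrow> nat" where k: "\<And>n. openin X {x \<in> topspace X. k x = n}"
      "\<And>n. compactin X {x \<in> topspace X. k x \<le> n}"
    using compact_open_partition[OF assms(5,7,8,6)] by blast
  obtain V :: "nat \<Rightarrow> 'a set" where V: "\<And>n. openin X (V n)" "\<And>n. closedin X (V n)"
      "\<And>U x. openin X U \<Longrightarrow> x \<in> U \<Longrightarrow> \<exists>n. x \<in> V n \<and> V n \<subseteq> U"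
    using countable_clopen_base[OF assms(5,7,8,6,4)] by blast
  \<comment> \<open>Label 0 is the piece number and label \<open>Suc i\<close> records membership in
    \<open>V i\<close>. Because of this shift, cylinders of depth \<open>Suc (Suc n)\<close> decide
    \<open>V n\<close>.\<close>
  define C where "C = case_nat k (\<lambda>i x. of_bool (x \<in> V i))"
  have C0: "C 0 = k"
    by (simp add: C_def)
  have V_in: "openin X {y \<in> topspace X. y \<in> V i}" and V_out: "openin X {y \<in> topspace X. y \<notin> V i}" for i
  proof -
    have "{y \<in> topspace X. y \<in> V i} = V i" "{y \<in> topspace X. y \<notin> V i} = topspace X - V i"
      using openin_subset[OF V(1)] by auto
    then show "openin X {y \<in> topspace X. y \<in> V i}" "openin X {y \<in> topspace X. y \<notin> V i}"
      using V by auto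
  qed
  have C_open: "openin X {y \<in> topspace X. C i y = j}" for i j
  proof (cases i)
    case 0
    then show ?thesis using k by (simp add: C0)
  next
    case (Suc n)
    then have "{y \<in> topspace X. C i y = j} = (if j = 0 then {y \<in> topspace X. y \<notin> V n}
        else if j = 1 then {y \<in> topspace X. y \<in> V n} else {})"
      by (auto simp: C_def of_bool_def split: if_splits)
    then show ?thesis
      using V_in[of n] V_out[of n] by (simp only: openin_empty split: if_split) simp
  qed
  have basis: "\<exists>n. cylinder X C n x \<subseteq> U" if U: "openin X U" "x \<in> U" for U x
  proof -
    obtain n where "x \<in> V n" "V n \<subseteq> U"
      using V(3)[OF U] by blast
    then have "cylinder X C (Suc (Suc n)) x \<subseteq> U"
      by (auto simp: cylinder_def C_def of_bool_def dest!: spec[of _ "Suc n"] split: if_splits)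
    then show ?thesis ..
  qed
  \<comment> \<open>If \<open>k\<close> were bounded on \<open>A\<close>, then \<open>A\<close>
    would be a closed subset of a compact sublevel set, hence compact.\<close>
  have A_far: "\<exists>a\<in>A. n < C 0 a" for n
  proof (rule ccontr)
    assume "\<not> ?thesis"
    then have "A \<subseteq> {x \<in> topspace X. k x \<le> n}"
      using AM by (auto simp: C0 M_def not_less)
    then show False
      using assms(9,11) closed_compactin[OF k(2)] by blast
  qed
  obtain r where r: "continuous_map X (subtopology X A) r" "\<And>x. x \<in> A \<Longrightarrow> r x = x"
      and kr: "\<And>x. x \<in> topspace X \<Longrightarrow> k x \<le> k (r x)"
    using cylinder_retraction[of X C A, OF C_open basis assms(9) A_far, unfolded C0] by metis
  have rA: "r x \<in> A" if "x \<in> M" for x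
    using continuous_map_funspace[OF r(1)] that by (auto simp: M_def)
  obtain s where s: "\<And>n. s n \<in> S" "\<And>n. 0 < s n" "s 0 \<le> \<eta>" "decseq s" "s \<longlonglongrightarrow> 0"
    using characteristic_null_sequence[OF assms(2,1)] by blast
  \<comment> \<open>Only base sets missing \<open>A\<close> count, so all labels are false on
    \<open>A\<close> and \<open>e\<close> vanishes there. A point off \<open>A\<close> still has
    small base sets of this kind separating it from any other point.\<close>
  define F where "F n x \<longleftrightarrow> x \<in> V n \<and> V n \<inter> A = {}" for n x
  have F_open: "openin X {y \<in> topspace X. F i y = j}" for i j
    using V_in[of i] V_out[of i] by (cases "V i \<inter> A = {}"; cases j) (auto simp: F_def)
  define e where "e = label_dist s F"
  have e_sym: "e x y = e y x" for x y
    by (simp add: e_def label_dist_commute)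
  have e_S: "e x y \<in> S" for x y
    using label_dist_values[of s F x y] S0 s(1) by (auto simp: e_def)
  have e_nonneg: "0 \<le> e x y" for x y
    using label_dist_values[of s F x y] s(2) by (auto simp: e_def less_imp_le)
  have e_le: "e x y \<le> \<eta>" for x y
    using label_dist_le[of s 0 F x y] s(2)[of 0] s(3,4) by (simp add: e_def)
  have e_A: "e x y = 0" if "x \<in> A" "y \<in> A" for x y
    unfolding e_def by (rule label_dist_cong) (use that in \<open>auto simp: F_def\<close>)
  have e_ultra: "e x y \<le> max (e x z) (e z y)" for x y z
    unfolding e_def by (rule label_dist_ultra) (use s less_imp_le in auto)
  have e_pos: "0 < e x y" if "x \<in> M - A" and "x \<noteq> y" for x y
  proof -
    have "openin X (M - A - {y})"
    proof (cases "y \<in> M")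
      case True
      then show ?thesis
        using assms(8,9) by (simp add: Hausdorff_imp_t1_space closedin_t1_singleton M_def openin_diff)
    next
      case False
      then show ?thesis
        using assms(9) by (simp add: M_def openin_diff)
    qed
    moreover have "x \<in> M - A - {y}"
      using that by blast
    ultimately obtain n where "x \<in> V n" "V n \<subseteq> M - A - {y}"
      using V(3) by blast
    then have "F n x \<noteq> F n y"
      by (auto simp: F_def)
    then have "s n \<le> e x y"
      unfolding e_def using label_dist_ge[of s F n x y] s(4) by blast
    then show ?thesis
      using s(2)[of n] by linarith
  qed
  \<comment> \<open>The pullback of \<open>d\<close> along \<open>r\<close> controls large
    distances, while \<open>e\<close> separates points that \<open>r\<close> identifies. Taking
    \<open>max\<close> keeps values in \<open>S\<close> and preserves the ultrametric
    inequality.\<close>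
  define D where "D x y = (if x \<in> M \<and> y \<in> M then max (d (r x) (r y)) (e x y) else 0)" for x y
  have D_ultra: "D x y \<le> max (D x z) (D z y)" if "x \<in> M" "y \<in> M" "z \<in> M" for x y z
    using that d(2)[of "r x" "r y" "r z"] e_ultra[of x y z] rA by (auto simp: D_def)
  have D_nonneg: "0 \<le> D x y" for x y
    by (simp add: D_def le_max_iff_disj)
  have D_zero: "D x y = 0 \<longleftrightarrow> x = y" if "x \<in> M" "y \<in> M" for x y
  proof
    assume "D x y = 0"
    then have "d (r x) (r y) \<le> 0" "e x y \<le> 0"
      using that by (auto simp: D_def split: if_splits)
    then have "r x = r y" "\<not> 0 < e x y" "\<not> 0 < e y x"
      using that rA A.nonneg[of "r x" "r y"] e_sym by (auto simp: antisym)
    \<comment> \<open>If either point is off \<open>A\<close>, \<open>e\<close> would separate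
      distinct points; if both are in \<open>A\<close>, \<open>r\<close> fixes them.\<close>
    then show "x = y"
      using e_pos[of x y] e_pos[of y x] r(2) that by (metis DiffI)
  next
    assume "x = y"
    then show "D x y = 0"
      using that rA by (simp add: D_def e_def label_dist_cong)
  qed
  interpret D: Metric_space M D
  proof
    show "D x y = D y x" for x y
      by (simp add: D_def e_sym A.commute)
    show "D x z \<le> D x y + D y z" if "x \<in> M" "y \<in> M" "z \<in> M" for x y z
      using D_ultra[of x z y] D_nonneg[of x y] D_nonneg[of y z] that by linarith
  qed (use D_nonneg D_zero in auto)
  have coarser: "\<exists>T. openin X T \<and> x \<in> T \<and> T \<subseteq> D.mball x \<epsilon>" if x: "x \<in> M" and \<epsilon>: "0 < \<epsilon>" for x \<epsilon>
  proof -
    obtain n where n: "s n < \<epsilon>"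
      using order_tendstoD(2)[OF s(5) \<epsilon>] by (auto simp: eventually_sequentially)
    \<comment> \<open>Continuity of \<open>r\<close> bounds the \<open>d\<close> part, and agreement
      of the first \<open>n\<close> labels bounds \<open>e\<close> by
      \<open>s n < \<epsilon>\<close>.\<close>
    let ?T = "{y \<in> topspace X. r y \<in> A.mball (r x) \<epsilon>} \<inter> cylinder X F n x"
    have "openin X {y \<in> topspace X. r y \<in> A.mball (r x) \<epsilon>}"
      using d_top A.openin_mball[of "r x" \<epsilon>] by (intro openin_continuous_map_preimage[OF r(1)]) simp
    then have "openin X ?T"
      using openin_cylinder[of X F, OF F_open] by blast
    moreover have "x \<in> ?T"
      using x rA \<epsilon> cylinder_self[of x X F] by (simp add: M_def)
    moreover have "?T \<subseteq> D.mball x \<epsilon>"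
    proof
      fix y assume y: "y \<in> ?T"
      then have "e x y \<le> s n"
        unfolding e_def by (intro label_dist_le) (use s less_imp_le in \<open>auto simp: cylinder_def\<close>)
      then show "y \<in> D.mball x \<epsilon>"
        using y x n by (simp add: D_def flip: M_def)
    qed
    ultimately show ?thesis by blast
  qed
  \<comment> \<open>The map \<open>r\<close> sends the \<open>D\<close>-ball into a
    \<open>d\<close>-ball of the same radius, which is compact by properness of \<open>d\<close> and
    so meets finitely many pieces. As \<open>k y \<le> k (r y)\<close>, this bounds \<open>k\<close>
    on the \<open>D\<close>-ball.\<close>
  have cpt: "\<exists>K. compactin X K \<and> D.mcball x B \<subseteq> K" if x: "x \<in> M" for x B
  proof -
    let ?\<U> = "range (\<lambda>n. {x \<in> topspace X. k x = n})"
    have "compactin X (A.mcball (r x) B)"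
      using assms(13) A.mbounded_mcball A.closedin_mcball d_top
      unfolding proper_metric_on_def by (metis compactin_subtopology)
    moreover have "openin X U" if "U \<in> ?\<U>" for U
      using that k(1) by blast
    moreover have "A.mcball (r x) B \<subseteq> \<Union>?\<U>"
      using AM by (auto simp: M_def)
    ultimately have "\<exists>\<F>. finite \<F> \<and> \<F> \<subseteq> ?\<U> \<and> A.mcball (r x) B \<subseteq> \<Union>\<F>"
      by (rule compactinD)
    then obtain \<F> where \<F>: "finite \<F>" "\<F> \<subseteq> ?\<U>" "A.mcball (r x) B \<subseteq> \<Union>\<F>"
      by (elim exE conjE)
    obtain I where I: "finite I" "\<F> = (\<lambda>n. {x \<in> topspace X. k x = n}) ` I"
      using finite_subset_image[OF \<F>(1,2)] by blast
    have "D.mcball x B \<subseteq> {y \<in> topspace X. k y \<le> Max I}"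
    proof
      fix y assume "y \<in> D.mcball x B"
      then have y: "y \<in> M" "r y \<in> A.mcball (r x) B"
        using x rA by (auto simp: D_def)
      then have "k (r y) \<in> I"
        using \<F>(3) I(2) by auto
      then show "y \<in> {y \<in> topspace X. k y \<le> Max I}"
        using kr[of y] y(1) Max_ge[OF I(1)] by (auto simp: M_def dest: order_trans)
    qed
    with k(2) show ?thesis by blast
  qed
  have "D.mtopology = X" "proper_metric_on M D"
    using D.mtopology_eqI_compact_balls[of X] coarser cpt M_def by blast+
  moreover have "D x y \<in> S" if "x \<in> M" "y \<in> M" for x y
    using that d(3) rA e_S by (simp add: D_def max_def)
  moreover have "D x y = d x y" if "x \<in> A" "y \<in> A" for x y
    using that AM r(2) e_A by (auto simp: D_def)
  \<comment> \<open>The witness is \<open>r x\<close>: since \<open>r (r x) = r x\<close>, the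
    \<open>d\<close> part vanishes and only \<open>e x (r x) \<le> \<eta>\<close> remains.\<close>
  moreover have "\<exists>y\<in>A. D x y \<le> \<eta>" if "x \<in> M" for x
    using that rA[OF that] AM r(2) e_le assms(1) by (intro bexI[of _ "r x"]) (auto simp: D_def)
  ultimately show ?thesis
    using D_ultra D.Metric_space_axioms AM
    unfolding UMet_def ultrametric_on_def eta_dense_def M_def[symmetric] by blast
qed

end
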